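(* Let $V$ be a discrete valuation domain of characteristic $2$, let $\pi$ be a uniformizer of $V$, and suppose that the residue field $L=V/\pi V$ is infinite. Set $$D=\mathbb F_2+\pi V=\{x\in V : x\bmod \pi V\in\mathbb F_2\},$$ where $\mathbb F_2$ denotes the prime subfield. Then there exists a domain $A$ with $D\subseteq A$ such that $$\operatorname{Int}(D)\subseteq\operatorname{Int}(A)\quad\text{but}\quad \operatorname{Int}(D^n)\nsubseteq\operatorname{Int}(A^n)\ \text{ for every } n\ge 2.$$ One may take $V=\mathbb F_2(s)[t]_{(t)}$ (with $s,t$ independent indeterminates), $\pi=t$, and $D=\mathbb F_2+t\,\mathbb F_2(s)[t]_{(t)}$; that is, these data satisfy the hypotheses, so the conclusion holds for this explicit $D$.
   Context: For a domain $R$ with quotient field $Q$ and $n\ge1$, the ring of integer-valued polynomials in $n$ variables is $\operatorname{Int}(R^n)=\{F\in Q[Z_1,\ldots,Z_n] : F(R^n)\subseteq R\}$, and $\operatorname{Int}(R)=\operatorname{Int}(R^1)$. For an extension of domains $R\subseteq B$, inclusions such as $\operatorname{Int}(R^n)\subseteq\operatorname{Int}(B^n)$ are taken through $Q=\operatorname{Frac}(R)\subseteq\operatorname{Frac}(B)$. *)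

theory Defs
  imports
    "HOL-Library.Poly_Mapping"
    "HOL-Library.Z2"
    "HOL-Computational_Algebra.Polynomial_Factorial"
begin

text \<open>
  Domains are represented as unital subrings of a type of class field; the quotient field of
  such a subring is then an actual subfield of the ambient field.
\<close>

definition subring_of_field :: "'a::field set \<Rightarrow> bool" where
  "subring_of_field R \<longleftrightarrow>
     1 \<in> R \<and> (\<forall>x\<in>R. \<forall>y\<in>R. x - y \<in> R) \<and> (\<forall>x\<in>R. \<forall>y\<in>R. x * y \<in> R)"

definition quotient_field :: "'a::field set \<Rightarrow> 'a set" where
  "quotient_field R = {a / b | a b. a \<in> R \<and> b \<in> R \<and> b \<noteq> 0}"

text \<open>
  The value at 0, conventionally infinite, is left unspecified.
\<close>

definition discrete_valuation_on :: "'a::field set \<Rightarrow> ('a \<Rightarrow> int) \<Rightarrow> bool" where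
  "discrete_valuation_on K v \<longleftrightarrow>
     (\<forall>x\<in>K - {0}. \<forall>y\<in>K - {0}. v (x * y) = v x + v y) \<and>
     (\<forall>x\<in>K - {0}. \<forall>y\<in>K - {0}. x + y \<noteq> 0 \<longrightarrow> min (v x) (v y) \<le> v (x + y)) \<and>
     v ` (K - {0}) = UNIV"

definition discrete_valuation_domain :: "'a::field set \<Rightarrow> bool" where
  "discrete_valuation_domain V \<longleftrightarrow> subring_of_field V \<and>
     (\<exists>v. discrete_valuation_on (quotient_field V) v \<and>
          V = {x \<in> quotient_field V. x = 0 \<or> 0 \<le> v x})"

definition principal_ideal :: "'a::field set \<Rightarrow> 'a \<Rightarrow> 'a set" where
  "principal_ideal R a = {a * x | x. x \<in> R}"

text \<open>
  A uniformizer generates the maximal ideal, which in a local ring is the set of nonunits.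
\<close>

definition uniformizer :: "'a::field set \<Rightarrow> 'a \<Rightarrow> bool" where
  "uniformizer V p \<longleftrightarrow> p \<in> V \<and> principal_ideal V p = {x \<in> V. \<not> (\<exists>y\<in>V. x * y = 1)}"

definition residue_ring :: "'a::field set \<Rightarrow> 'a \<Rightarrow> 'a set set" where
  "residue_ring V p = V // {(x, y). x \<in> V \<and> y \<in> V \<and> x - y \<in> principal_ideal V p}"

text \<open>
  The ring \<open>F_2 + p V\<close>; it is only used over fields of characteristic 2, where \<open>{0, 1}\<close> is the
  prime subfield.
\<close>

definition F2_plus :: "'a::field set \<Rightarrow> 'a \<Rightarrow> 'a set" where
  "F2_plus V p = {c + m | c m. c \<in> {0, 1} \<and> m \<in> principal_ideal V p}"

lemma F2_plus_altdef:
  assumes "subring_of_field V" and "p \<in> V"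
  shows "F2_plus V p = {x \<in> V. \<exists>c\<in>{0, 1}. x - c \<in> principal_ideal V p}" (is "_ = ?S")
proof
  have "1 \<in> V"
    using assms by (auto simp: subring_of_field_def)
  have diff: "x - y \<in> V" if "x \<in> V" "y \<in> V" for x y
    using assms that by (auto simp: subring_of_field_def)
  have zero: "0 \<in> V"
    using diff[OF \<open>1 \<in> V\<close> \<open>1 \<in> V\<close>] by simp
  have add: "x + y \<in> V" if "x \<in> V" "y \<in> V" for x y
    using diff[OF that(1) diff[OF zero that(2)]] by simp
  have ideal: "principal_ideal V p \<subseteq> V"
    using assms by (auto simp: principal_ideal_def subring_of_field_def)
  show "F2_plus V p \<subseteq> ?S"
  proof
    fix x assume "x \<in> F2_plus V p"
    then obtain c m where cm: "x = c + m" "c \<in> {0, 1}" "m \<in> principal_ideal V p"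
      unfolding F2_plus_def by blast
    then have "c \<in> V" "m \<in> V"
      using ideal zero \<open>1 \<in> V\<close> by blast+
    moreover have "x - c \<in> principal_ideal V p"
      using cm by simp
    ultimately show "x \<in> ?S"
      using cm add by blast
  qed
  show "?S \<subseteq> F2_plus V p"
  proof
    fix x assume "x \<in> ?S"
    then obtain c where c: "c \<in> {0, 1}" "x - c \<in> principal_ideal V p"
      by blast
    have "x = c + (x - c)"
      by simp
    with c show "x \<in> F2_plus V p"
      unfolding F2_plus_def by blast
  qed
qed

text \<open>
  Polynomials in the variables \<open>Z_0, Z_1, \<dots>\<close>: a finitely supported map assigning a coefficient
  to each monomial, where a monomial is a finitely supported map from variable indices to
  exponents.
\<close>

type_synonym 'a mpolynomial = "(nat \<Rightarrow>\<^sub>0 nat) \<Rightarrow>\<^sub>0 'a"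

text \<open>The polynomials in the variables \<open>Z_0, \<dots>, Z_(n-1)\<close> with coefficients in \<open>K\<close>.\<close>

definition mpolynomials :: "'a::field set \<Rightarrow> nat \<Rightarrow> 'a mpolynomial set" where
  "mpolynomials K n =
     {F. \<forall>m\<in>Poly_Mapping.keys F. Poly_Mapping.keys m \<subseteq> {..<n} \<and> Poly_Mapping.lookup F m \<in> K}"

definition mpoly_eval :: "'a::field mpolynomial \<Rightarrow> (nat \<Rightarrow> 'a) \<Rightarrow> 'a" where
  "mpoly_eval F z =
     (\<Sum>m\<in>Poly_Mapping.keys F.
        Poly_Mapping.lookup F m * (\<Prod>i\<in>Poly_Mapping.keys m. z i ^ Poly_Mapping.lookup m i))"

text \<open>\<open>int_valued R n\<close> is \<open>Int(R^n)\<close>.\<close>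

definition int_valued :: "'a::field set \<Rightarrow> nat \<Rightarrow> 'a mpolynomial set" where
  "int_valued R n =
     {F \<in> mpolynomials (quotient_field R) n. \<forall>z. (\<forall>i<n. z i \<in> R) \<longrightarrow> mpoly_eval F z \<in> R}"

text \<open>
  HOL cannot quantify existentially over types, so the extension domain has to be sought inside a
  specific field; we use the rational function field \<open>k(X,Y)\<close> over the ambient field \<open>k\<close>.
  \<open>ratfun_const\<close> is the inclusion of \<open>k\<close> as constants, and \<open>mpoly_const\<close> applies it to the
  coefficients of a polynomial, so that it induces the inclusion of \<open>Frac(R)[Z]\<close> into
  \<open>Frac(B)[Z]\<close> when \<open>R\<close> is mapped into \<open>B\<close>.
\<close>

definition ratfun_const :: "'a::field \<Rightarrow> 'a poly poly fract" where
  "ratfun_const c = to_fract [:[:c:]:]"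

definition mpoly_const :: "'a::field mpolynomial \<Rightarrow> 'a poly poly fract mpolynomial" where
  "mpoly_const F = Poly_Mapping.map ratfun_const F"

text \<open>
  The localization of \<open>F_2(s)[t]\<close> at the prime ideal \<open>(t)\<close>, inside \<open>F_2(s)(t)\<close>. The type
  \<open>bit\<close> is the field with two elements, so \<open>bit poly fract\<close> is \<open>F_2(s)\<close>.
\<close>

definition t_elem :: "bit poly fract poly fract" where
  "t_elem = to_fract [:0, 1:]"

definition V_st :: "bit poly fract poly fract set" where
  "V_st = {to_fract f / to_fract g | f g. \<not> [:0, 1:] dvd g}"

end

theory Submission
  imports Defs
begin

text \<open>
  Write \<open>D\<close> for \<open>F_2 + p V\<close>. Because the residue field is infinite, a polynomial over the quotient
  field that maps \<open>V\<close> into \<open>D\<close> has its coefficients in \<open>V\<close> and is constant modulo \<open>p\<close>: its reduction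
  takes only the values 0 and 1 on an infinite field. Since \<open>D\<close> consists of the elements \<open>c + p x\<close>
  with \<open>c \<in> {0, 1}\<close> and \<open>x \<in> V\<close>, every \<open>f \<in> Int(D)\<close> therefore satisfies
  \<open>f(c + p X) = d + p q(X)\<close> with \<open>d \<in> {0, 1}\<close> and \<open>q \<in> V[X]\<close> (\<open>int_valued_affine_substitution\<close>).

  Consequently, if \<open>J\<close> is a \<open>V\<close>-submodule of some \<open>V\<close>-algebra and contains all powers
  \<open>G^n\<close>, \<open>n \<ge> 0\<close>, of its elements, then \<open>A = {0, 1} + p J\<close> is mapped into itself by
  \<open>Int(D)\<close>. Closure under powers involves one element at a time, whereas the two-variable polynomial
  \<open>(Z_0 + Z_0^2) (Z_1 + Z_1^2) / p\<close>, which lies in \<open>Int(D^2)\<close>, produces products of two different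
  elements of \<open>J\<close>. It remains to find a \<open>J\<close> that is closed under powers but not under products.

  Characteristic 2 provides one. In \<open>V[x, y]\<close>, let \<open>J\<close> consist of the polynomials whose
  coefficients at the monomials with both exponents odd are divisible by \<open>p\<close>. A square in
  \<open>V[x, y]\<close> involves only monomials with both exponents even, and multiplication by such monomials
  preserves the parities of exponents; hence \<open>G^(n+2) = G^2 G^n\<close> shows that \<open>J\<close> is closed under
  powers (\<open>J_square_mult\<close>, \<open>J_power\<close>). Moreover \<open>p V[x, y]\<close> is contained in \<open>J\<close>, which makes \<open>A\<close>
  a ring. But \<open>x\<close> and \<open>y\<close> lie in \<open>J\<close> while \<open>x y\<close> does not, and evaluating the above polynomial at
  \<open>(p x, p y)\<close> gives a polynomial whose coefficient at \<open>x y\<close> is \<open>p\<close>, whereas elements of \<open>A\<close> have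
  that coefficient in \<open>p^2 V\<close>.

  For the explicit data, the order of vanishing at 0 is a discrete valuation on \<open>k(t)\<close> with
  valuation ring \<open>k[t]_(t)\<close>; it takes the value 1 at \<open>t\<close>, and distinct constants are incongruent
  modulo \<open>t\<close>.
\<close>

section \<open>Subrings of a field and coefficientwise membership\<close>

lemma
  assumes "subring_of_field R"
  shows subring_one: "1 \<in> R"
    and subring_diff: "\<And>x y. x \<in> R \<Longrightarrow> y \<in> R \<Longrightarrow> x - y \<in> R"
    and subring_mult: "\<And>x y. x \<in> R \<Longrightarrow> y \<in> R \<Longrightarrow> x * y \<in> R"
  using assms by (auto simp: subring_of_field_def)

lemma subring_zero: "subring_of_field R \<Longrightarrow> 0 \<in> R"
  using subring_diff[of R 1 1] subring_one[of R] by simp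

lemma subring_uminus: "subring_of_field R \<Longrightarrow> x \<in> R \<Longrightarrow> - x \<in> R"
  using subring_diff[of R 0 x] subring_zero[of R] by simp

lemma subring_add: "subring_of_field R \<Longrightarrow> x \<in> R \<Longrightarrow> y \<in> R \<Longrightarrow> x + y \<in> R"
  using subring_diff[of R x "- y"] subring_uminus[of R y] by simp

lemma subring_power: "subring_of_field R \<Longrightarrow> x \<in> R \<Longrightarrow> x ^ n \<in> R"
  by (induction n) (simp_all add: subring_one subring_mult)

lemma subring_sum: "subring_of_field R \<Longrightarrow> (\<And>i. i \<in> I \<Longrightarrow> f i \<in> R) \<Longrightarrow> sum f I \<in> R"
  by (induction I rule: infinite_finite_induct) (simp_all add: subring_zero subring_add)

lemma subring_quotient_field:
  assumes "subring_of_field R"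
  shows "subring_of_field (quotient_field R)"
  unfolding subring_of_field_def
proof (intro conjI ballI)
  show "1 \<in> quotient_field R"
    unfolding quotient_field_def using subring_one[OF assms] by (intro CollectI exI[of _ 1]) simp
next
  fix x y assume "x \<in> quotient_field R" "y \<in> quotient_field R"
  then obtain a b c d where *: "a \<in> R" "b \<in> R" "b \<noteq> 0" "x = a / b" "c \<in> R" "d \<in> R" "d \<noteq> 0" "y = c / d"
    unfolding quotient_field_def by blast
  have "x - y = (a * d - c * b) / (b * d)" "x * y = (a * c) / (b * d)"
    using *(3,7) unfolding *(4,8) by (simp_all add: field_simps)
  moreover have "a * d - c * b \<in> R" "a * c \<in> R" "b * d \<in> R" "b * d \<noteq> 0"
    using *(1-3,5-7) by (simp_all add: subring_diff[OF assms] subring_mult[OF assms])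
  ultimately show "x - y \<in> quotient_field R" "x * y \<in> quotient_field R"
    unfolding quotient_field_def by blast+
qed

lemma subring_subset_quotient_field: "subring_of_field R \<Longrightarrow> R \<subseteq> quotient_field R"
proof
  fix x assume "subring_of_field R" "x \<in> R"
  then show "x \<in> quotient_field R"
    unfolding quotient_field_def using subring_one[of R]
    by (intro CollectI exI[of _ x] exI[of _ 1]) simp
qed

lemma quotient_field_mono: "R \<subseteq> S \<Longrightarrow> quotient_field R \<subseteq> quotient_field S"
  unfolding quotient_field_def by blast

lemma divide_in_quotient_field:
  "x \<in> R \<Longrightarrow> y \<in> R \<Longrightarrow> y \<noteq> 0 \<Longrightarrow> x / y \<in> quotient_field R"
  unfolding quotient_field_def by blast

definition coeffs_in :: "'a::zero set \<Rightarrow> 'a poly \<Rightarrow> bool" where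
  "coeffs_in R q \<longleftrightarrow> (\<forall>i. coeff q i \<in> R)"

lemma coeffs_in_pCons: "coeffs_in R (pCons a q) \<longleftrightarrow> a \<in> R \<and> coeffs_in R q"
  unfolding coeffs_in_def by (auto simp: coeff_pCons split: nat.splits)

context
  fixes R :: "'a::field set"
  assumes R: "subring_of_field R"
begin

lemma coeffs_in_const: "a \<in> R \<Longrightarrow> coeffs_in R [:a:]"
  using subring_zero[OF R] by (auto simp: coeffs_in_def coeff_pCons split: nat.splits)

lemma coeffs_in_diff: "coeffs_in R q \<Longrightarrow> coeffs_in R r \<Longrightarrow> coeffs_in R (q - r)"
  using subring_diff[OF R] by (simp add: coeffs_in_def)

lemma coeffs_in_mult: "coeffs_in R q \<Longrightarrow> coeffs_in R r \<Longrightarrow> coeffs_in R (q * r)"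
  unfolding coeffs_in_def coeff_mult by (intro allI subring_sum[OF R] subring_mult[OF R]) blast+

lemma coeffs_in_power: "coeffs_in R q \<Longrightarrow> coeffs_in R (q ^ n)"
  using coeffs_in_const[OF subring_one[OF R]]
  by (induction n) (simp_all add: coeffs_in_mult one_pCons)

lemma coeffs_in_smult: "a \<in> R \<Longrightarrow> coeffs_in R q \<Longrightarrow> coeffs_in R (smult a q)"
  using subring_mult[OF R] by (simp add: coeffs_in_def)

lemma coeffs_in_sum: "(\<And>i. i \<in> I \<Longrightarrow> coeffs_in R (f i)) \<Longrightarrow> coeffs_in R (sum f I)"
  unfolding coeffs_in_def coeff_sum by (intro allI subring_sum[OF R]) blast

lemma poly_in_subring: "coeffs_in R q \<Longrightarrow> x \<in> R \<Longrightarrow> poly q x \<in> R"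
  unfolding coeffs_in_def poly_altdef
  by (intro subring_sum[OF R] subring_mult[OF R] subring_power[OF R]) blast+

lemma coeffs_in_synthetic_div:
  "coeffs_in R q \<Longrightarrow> a \<in> R \<Longrightarrow> coeffs_in R (synthetic_div q a)"
proof (induction q)
  case 0
  then show ?case by simp
next
  case (pCons b q)
  then show ?case
    using poly_in_subring[of q a] by (simp add: coeffs_in_pCons)
qed

end

section \<open>Discrete valuations and uniformizers\<close>

context
  fixes V :: "'a::field set" and v
  assumes V: "subring_of_field V"
    and v: "discrete_valuation_on (quotient_field V) v"
    and V_eq: "V = {x \<in> quotient_field V. x = 0 \<or> 0 \<le> v x}"
begin

lemma valuation_ring_iff: "x \<in> V \<longleftrightarrow> x \<in> quotient_field V \<and> (x = 0 \<or> 0 \<le> v x)"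
  by (subst V_eq) simp

lemma valuation_mult:
  "x \<in> quotient_field V \<Longrightarrow> y \<in> quotient_field V \<Longrightarrow> x \<noteq> 0 \<Longrightarrow> y \<noteq> 0 \<Longrightarrow> v (x * y) = v x + v y"
  using v unfolding discrete_valuation_on_def by blast

lemma one_in_quotient_field: "1 \<in> quotient_field V"
  using subring_one[OF subring_quotient_field[OF V]] .

lemma valuation_one: "v 1 = 0"
  using valuation_mult[of 1 1] one_in_quotient_field by simp

lemma inverse_in_quotient_field:
  assumes "x \<in> quotient_field V" "x \<noteq> 0"
  shows "1 / x \<in> quotient_field V"
proof -
  obtain a b where "a \<in> V" "b \<in> V" "b \<noteq> 0" "x = a / b"
    using assms(1) unfolding quotient_field_def by blast
  then show ?thesis
    using assms(2) divide_in_quotient_field[of b V a] by simp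
qed

lemma valuation_inverse:
  assumes "x \<in> quotient_field V" "x \<noteq> 0"
  shows "v (1 / x) = - v x"
  using valuation_mult[of x "1 / x"] inverse_in_quotient_field[OF assms] assms valuation_one by simp

lemma valuation_power:
  assumes "x \<in> quotient_field V" "x \<noteq> 0"
  shows "v (x ^ n) = int n * v x"
proof (induction n)
  case (Suc n)
  then show ?case
    using valuation_mult[of x "x ^ n"] assms subring_power[OF subring_quotient_field[OF V], of x n]
    by (simp add: algebra_simps)
qed (simp add: valuation_one)

lemma unit_iff_valuation_zero:
  assumes "x \<in> V" "x \<noteq> 0"
  shows "(\<exists>y\<in>V. x * y = 1) \<longleftrightarrow> v x = 0"
proof
  assume "\<exists>y\<in>V. x * y = 1"
  then obtain y where y: "y \<in> V" "x * y = 1" by blast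
  then have "y \<noteq> 0" by auto
  then have "v x + v y = 0" "v x \<ge> 0" "v y \<ge> 0"
    using y valuation_mult[of x y] assms valuation_ring_iff[of x] valuation_ring_iff[of y] valuation_one by auto
  then show "v x = 0" by simp
next
  assume "v x = 0"
  then have "1 / x \<in> V"
    using assms valuation_ring_iff[of x] valuation_ring_iff[of "1 / x"] inverse_in_quotient_field[of x] valuation_inverse[of x] by auto
  then show "\<exists>y\<in>V. x * y = 1" using assms by (intro bexI[of _ "1 / x"]) auto
qed

lemma principal_ideal_valuation_one:
  assumes "q \<in> quotient_field V" "q \<noteq> 0" "v q = 1"
  shows "principal_ideal V q = {x \<in> V. x = 0 \<or> 1 \<le> v x}"
proof (intro equalityI subsetI)
  fix x assume "x \<in> principal_ideal V q"
  then obtain y where y: "y \<in> V" "x = q * y" unfolding principal_ideal_def by blast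
  show "x \<in> {x \<in> V. x = 0 \<or> 1 \<le> v x}"
  proof (cases "y = 0")
    case True
    then show ?thesis using y subring_zero[OF V] by simp
  next
    case False
    then have "v x = 1 + v y" "v y \<ge> 0"
      using y assms valuation_ring_iff[of y] valuation_mult[of q y] by auto
    moreover have "q \<in> V" using assms valuation_ring_iff[of q] by simp
    ultimately show ?thesis using y subring_mult[OF V] by auto
  qed
next
  fix x assume x: "x \<in> {x \<in> V. x = 0 \<or> 1 \<le> v x}"
  have "x * (1 / q) \<in> quotient_field V"
    using x assms valuation_ring_iff[of x]
    by (intro subring_mult[OF subring_quotient_field[OF V]] inverse_in_quotient_field) auto
  moreover have "0 \<le> v (x * (1 / q))" if "x \<noteq> 0"
    using valuation_mult[of x "1 / q"] x that assms valuation_inverse[of q] inverse_in_quotient_field[of q] valuation_ring_iff[of x]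
    by auto
  ultimately have "x / q \<in> V" using valuation_ring_iff[of "x / q"] assms by auto
  then show "x \<in> principal_ideal V q"
    unfolding principal_ideal_def using assms by (intro CollectI exI[of _ "x / q"]) simp
qed

lemma nonunits_eq: "{x \<in> V. \<not> (\<exists>y\<in>V. x * y = 1)} = {x \<in> V. x = 0 \<or> 1 \<le> v x}"
proof -
  have "\<not> (\<exists>y\<in>V. x * y = 1) \<longleftrightarrow> x = 0 \<or> 1 \<le> v x" if "x \<in> V" for x
  proof (cases "x = 0")
    case False
    then have "0 \<le> v x" using that valuation_ring_iff[of x] by simp
    then show ?thesis using unit_iff_valuation_zero[OF that False] False by auto
  qed auto
  then show ?thesis by blast
qed

text \<open>
  Surjectivity of the valuation supplies an element of value 1; it is a nonunit, hence a multiple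
  of the uniformizer, which forces the uniformizer to have value 1 as well.
\<close>

lemma uniformizer_iff_valuation:
  "uniformizer V q \<longleftrightarrow> q \<in> quotient_field V \<and> q \<noteq> 0 \<and> v q = 1"
proof
  assume q: "uniformizer V q"
  then have qV: "q \<in> V" and eq: "principal_ideal V q = {x \<in> V. x = 0 \<or> 1 \<le> v x}"
    unfolding uniformizer_def nonunits_eq by simp_all
  have "1 \<in> v ` (quotient_field V - {0})"
    using v unfolding discrete_valuation_on_def by simp
  then obtain x where "1 = v x" "x \<in> quotient_field V - {0}"
    by (rule imageE)
  then have x: "x \<in> quotient_field V" "x \<noteq> 0" "v x = 1"
    by simp_all
  then have "x \<in> principal_ideal V q" unfolding eq using valuation_ring_iff[of x] by simp
  then obtain y where y: "y \<in> V" "x = q * y" unfolding principal_ideal_def by blast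
  have "q \<noteq> 0" "y \<noteq> 0" using x y by auto
  have "q \<in> principal_ideal V q"
    unfolding principal_ideal_def using subring_one[OF V] by (intro CollectI exI[of _ 1]) simp
  then have "1 \<le> v q" unfolding eq using \<open>q \<noteq> 0\<close> by simp
  moreover have "v x = v q + v y" "0 \<le> v y" "q \<in> quotient_field V"
    using valuation_mult[of q y] y qV valuation_ring_iff[of q] valuation_ring_iff[of y] \<open>q \<noteq> 0\<close> \<open>y \<noteq> 0\<close> by auto
  ultimately show "q \<in> quotient_field V \<and> q \<noteq> 0 \<and> v q = 1" using x \<open>q \<noteq> 0\<close> by auto
next
  assume q: "q \<in> quotient_field V \<and> q \<noteq> 0 \<and> v q = 1"
  then have "q \<in> V" using valuation_ring_iff[of q] by simp
  with q show "uniformizer V q"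
    unfolding uniformizer_def nonunits_eq using principal_ideal_valuation_one[of q] by simp
qed

end

section \<open>Polynomials over a valuation ring with infinite residue field\<close>

text \<open>
  The properties of the valuation ring on which the construction rests, stated without the
  valuation.
\<close>

locale infinite_residue_dvr =
  fixes V :: "'k::field set" and p :: 'k
  assumes V: "subring_of_field V"
    and p: "p \<in> V" "p \<noteq> 0"
    and nonunit: "\<And>y. y \<in> V \<Longrightarrow> p * y \<noteq> 1"
    and prime_ideal: "\<And>x y. x \<in> V \<Longrightarrow> y \<in> V \<Longrightarrow> x * y \<in> principal_ideal V p \<Longrightarrow>
           x \<in> principal_ideal V p \<or> y \<in> principal_ideal V p"
    and clears_denominators: "\<And>x. x \<in> quotient_field V \<Longrightarrow> \<exists>k. p ^ k * x \<in> V"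
    and infinite_residue_ring: "infinite (residue_ring V p)"
    and one_plus_one: "(1::'k) + 1 = 0"

lemma infinite_residue_dvrI:
  fixes V :: "'k::field set"
  assumes "CHAR('k) = 2" "discrete_valuation_domain V" "uniformizer V p" "infinite (residue_ring V p)"
  shows "infinite_residue_dvr V p"
proof -
  note dvd = assms(2)[unfolded discrete_valuation_domain_def]
  note V = conjunct1[OF dvd]
  obtain v where vV: "discrete_valuation_on (quotient_field V) v \<and>
      V = {x \<in> quotient_field V. x = 0 \<or> 0 \<le> v x}"
    using conjunct2[OF dvd] by (rule exE)
  note v = conjunct1[OF vV] and V_eq = conjunct2[OF vV]
  note val = V v V_eq
  note V_iff = valuation_ring_iff[OF val]
  have pQ: "p \<in> quotient_field V" "p \<noteq> 0" "v p = 1"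
    using assms(3) uniformizer_iff_valuation[OF val, of p] by simp_all
  have P: "principal_ideal V p = {x \<in> V. x = 0 \<or> 1 \<le> v x}"
    using principal_ideal_valuation_one[OF val pQ] .
  show ?thesis
  proof
    show "subring_of_field V" by fact
    show "p \<in> V" using V_iff[of p] pQ by simp
    show "p \<noteq> 0" by fact
    show "infinite (residue_ring V p)" by fact
    show "(1::'k) + 1 = 0"
      using of_nat_CHAR[where 'a = 'k] assms(1) by (metis of_nat_numeral one_add_one)
    show "p * y \<noteq> 1" if "y \<in> V" for y
      using unit_iff_valuation_zero[OF val, of p] that pQ \<open>p \<in> V\<close> by auto
    show "x \<in> principal_ideal V p \<or> y \<in> principal_ideal V p"
      if "x \<in> V" "y \<in> V" "x * y \<in> principal_ideal V p" for x y
    proof (rule ccontr)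
      assume "\<not> ?thesis"
      then have "x \<noteq> 0" "y \<noteq> 0" "v x < 1" "v y < 1" "0 \<le> v x" "0 \<le> v y"
        using that V_iff[of x] V_iff[of y] unfolding P by auto
      moreover have "v (x * y) = v x + v y"
        using valuation_mult[OF val, of x y] calculation that V_iff[of x] V_iff[of y] by simp
      ultimately show False using that(3) unfolding P by auto
    qed
    show "\<exists>k. p ^ k * x \<in> V" if x: "x \<in> quotient_field V" for x
    proof (cases "x = 0")
      case True
      then show ?thesis using subring_zero[OF V] by simp
    next
      case False
      define k where "k = nat (- v x)"
      have pk: "p ^ k \<in> quotient_field V"
        by (intro subring_power subring_quotient_field V pQ)
      have "v (p ^ k * x) = int k * v p + v x"
        using valuation_mult[OF val pk x] valuation_power[OF val pQ(1,2)] False pQ by simp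
      then have "0 \<le> v (p ^ k * x)" using pQ unfolding k_def by simp
      moreover have "p ^ k * x \<in> quotient_field V"
        by (intro subring_mult subring_quotient_field V pk x)
      ultimately have "p ^ k * x \<in> V" using V_iff[of "p ^ k * x"] by simp
      then show ?thesis ..
    qed
  qed
qed

context infinite_residue_dvr
begin

abbreviation "P \<equiv> principal_ideal V p"
abbreviation "D \<equiv> F2_plus V p"

lemma ideal_iff: "x \<in> P \<longleftrightarrow> (\<exists>y\<in>V. x = p * y)"
  unfolding principal_ideal_def by blast

lemma ideal_mult_generator: "x \<in> V \<Longrightarrow> p * x \<in> P"
  unfolding ideal_iff by blast

lemma ideal_generatorE:
  assumes "x \<in> P"
  obtains y where "y \<in> V" "x = p * y"
  using assms unfolding ideal_iff by blast

lemma ideal_subset: "x \<in> P \<Longrightarrow> x \<in> V"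
  by (elim ideal_generatorE) (simp add: subring_mult[OF V p(1)])

lemma ideal_mult_left: "x \<in> V \<Longrightarrow> y \<in> P \<Longrightarrow> x * y \<in> P"
  using ideal_mult_generator[OF subring_mult[OF V, of x]]
  by (elim ideal_generatorE) (simp add: mult.left_commute)

lemma ideal_zero: "0 \<in> P"
  using ideal_mult_generator[OF subring_zero[OF V]] by simp

lemma ideal_diff:
  assumes "x \<in> P" "y \<in> P"
  shows "x - y \<in> P"
proof -
  obtain a b where "a \<in> V" "x = p * a" "b \<in> V" "y = p * b"
    using assms by (elim ideal_generatorE)
  then show ?thesis
    using ideal_mult_generator[OF subring_diff[OF V, of a b]] by (simp add: right_diff_distrib)
qed

lemma ideal_uminus: "x \<in> P \<Longrightarrow> - x \<in> P"
  using ideal_diff[OF ideal_zero] by simp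

lemma ideal_add: "x \<in> P \<Longrightarrow> y \<in> P \<Longrightarrow> x + y \<in> P"
  using ideal_diff[of x "- y"] ideal_uminus[of y] by simp

lemma ideal_sum: "(\<And>i. i \<in> I \<Longrightarrow> f i \<in> P) \<Longrightarrow> sum f I \<in> P"
  by (induction I rule: infinite_finite_induct) (auto intro: ideal_zero ideal_add)

lemma one_not_in_ideal: "1 \<notin> P"
  using nonunit by (metis ideal_generatorE)

lemma D_subset: "D \<subseteq> V"
  using F2_plus_altdef[OF V p(1)] by auto

lemma D_iff: "x \<in> D \<longleftrightarrow> x \<in> P \<or> x - 1 \<in> P"
  unfolding F2_plus_altdef[OF V p(1)]
  using ideal_subset[of x] ideal_subset[of "x - 1"] subring_add[OF V _ subring_one[OF V], of "x - 1"]
  by auto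

text \<open>
  Representatives of the residue classes; they replace the elements of the residue field, so that
  roots of reduced polynomials can be counted inside \<open>V\<close>.
\<close>

lemma incongruent_points:
  obtains S where "infinite S" "S \<subseteq> V" "\<And>x y. x \<in> S \<Longrightarrow> y \<in> S \<Longrightarrow> x \<noteq> y \<Longrightarrow> x - y \<notin> P"
proof -
  define r where "r = {(x, y). x \<in> V \<and> y \<in> V \<and> x - y \<in> P}"
  define rep where "rep X = (SOME x. x \<in> X)" for X :: "'k set"
  have r_iff: "(x, y) \<in> r \<longleftrightarrow> x \<in> V \<and> y \<in> V \<and> x - y \<in> P" for x y
    unfolding r_def by simp
  have trans: "x - z \<in> P" if "x - y \<in> P" "y - z \<in> P" for x y z
    using ideal_add[OF that] by simp
  have sym: "y - x \<in> P" if "x - y \<in> P" for x y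
    using ideal_uminus[OF that] by simp
  have rep: "rep (r `` {x}) \<in> V \<and> x - rep (r `` {x}) \<in> P" if "x \<in> V" for x
  proof -
    have "x \<in> r `` {x}" unfolding r_def using that ideal_zero by simp
    then have "rep (r `` {x}) \<in> r `` {x}" unfolding rep_def by (rule someI)
    then have "(x, rep (r `` {x})) \<in> r" by simp
    then show ?thesis using r_iff by blast
  qed
  have class_eq: "r `` {x} = r `` {y}"
    if "x \<in> V" "y \<in> V" "rep (r `` {x}) - rep (r `` {y}) \<in> P" for x y
  proof -
    have "x - y \<in> P"
      using trans[OF conjunct2[OF rep[OF that(1)]] trans[OF that(3) sym[OF conjunct2[OF rep[OF that(2)]]]]] .
    then show ?thesis
      using that trans sym r_iff by (intro equalityI subsetI) (metis Image_singleton_iff)+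
  qed
  show ?thesis
  proof
    have "inj_on rep (V // r)"
      using class_eq ideal_zero by (force simp: inj_on_def quotient_def)
    then show "infinite (rep ` (V // r))"
      using infinite_residue_ring finite_imageD unfolding residue_ring_def r_def by blast
    show "rep ` (V // r) \<subseteq> V"
      using rep by (auto simp: quotient_def)
    show "x - y \<notin> P" if xy: "x \<in> rep ` (V // r)" "y \<in> rep ` (V // r)" "x \<noteq> y" for x y
    proof -
      obtain a b where "a \<in> V" "b \<in> V" "x = rep (r `` {a})" "y = rep (r `` {b})"
        using xy by (auto simp: quotient_def)
      then show ?thesis using class_eq[of a b] xy(3) by auto
    qed
  qed
qed

text \<open>
  This is the statement that a nonzero polynomial over the residue field has finitely many roots,
  proved by splitting off one root at a time. Primality of the ideal plays the part of the
  absence of zero divisors in the residue field.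
\<close>

lemma coeffs_in_ideal_if_roots:
  assumes "coeffs_in V f" "infinite S" "S \<subseteq> V"
    and "\<And>x y. x \<in> S \<Longrightarrow> y \<in> S \<Longrightarrow> x \<noteq> y \<Longrightarrow> x - y \<notin> P"
    and "\<And>x. x \<in> S \<Longrightarrow> poly f x \<in> P"
  shows "coeffs_in P f"
  using assms
proof (induction "degree f" arbitrary: f S)
  case 0
  obtain a where "a \<in> S" using \<open>infinite S\<close> infinite_imp_nonempty by blast
  obtain c where "f = [:c:]" using degree_eq_zeroE 0(1) by metis
  then show ?case using 0(6)[OF \<open>a \<in> S\<close>] ideal_zero
    by (simp add: coeffs_in_def coeff_pCons split: nat.splits)
next
  case (Suc d)
  obtain a where a: "a \<in> S" using \<open>infinite S\<close> infinite_imp_nonempty by blast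
  then have aV: "a \<in> V" using Suc by blast
  define q where "q = synthetic_div f a"
  have f: "f = [:- a, 1:] * q + [:poly f a:]"
    unfolding q_def by (rule synthetic_div_correct'[symmetric])
  have qV: "coeffs_in V q" unfolding q_def by (intro coeffs_in_synthetic_div V Suc aV)
  have qP: "coeffs_in P q"
  proof (rule Suc(1))
    show "d = degree q" unfolding q_def using Suc(2) by (simp add: degree_synthetic_div)
    show "coeffs_in V q" by fact
    show "infinite (S - {a})" using Suc by simp
    show "S - {a} \<subseteq> V" using Suc by blast
    show "x - y \<notin> P" if "x \<in> S - {a}" "y \<in> S - {a}" "x \<noteq> y" for x y
      using that Suc(6) by blast
    show "poly q x \<in> P" if x: "x \<in> S - {a}" for x
    proof -
      have "poly f x = (x - a) * poly q x + poly f a"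
        by (subst f) (simp add: algebra_simps)
      then have "(x - a) * poly q x = poly f x - poly f a" by simp
      moreover have "poly f x - poly f a \<in> P" using Suc(7) x a ideal_diff by blast
      ultimately have "(x - a) * poly q x \<in> P" by simp
      moreover have "x - a \<in> V" "poly q x \<in> V" "x - a \<notin> P"
        using x a Suc aV subring_diff[OF V] poly_in_subring[OF V qV] by auto
      ultimately show ?thesis using prime_ideal by blast
    qed
  qed
  have "f = pCons (poly f a) q - smult a q"
    by (subst f) (simp add: algebra_simps)
  moreover have "coeff (pCons (poly f a) q - smult a q) i \<in> P" for i
    using qP Suc(7)[OF a] aV
    by (auto simp: coeffs_in_def coeff_pCons split: nat.splits intro!: ideal_diff ideal_mult_left)
  ultimately show ?case unfolding coeffs_in_def by metis
qed

text \<open>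
  One of the two residues 0 and 1 is taken at infinitely many incongruent points, so the polynomial
  is congruent to that constant.
\<close>

lemma two_valued_mod_ideal:
  assumes "coeffs_in V f" "\<And>x. x \<in> V \<Longrightarrow> poly f x \<in> D" "0 < i"
  shows "coeff f i \<in> P"
proof -
  obtain S where S: "infinite S" "S \<subseteq> V" "\<And>x y. x \<in> S \<Longrightarrow> y \<in> S \<Longrightarrow> x \<noteq> y \<Longrightarrow> x - y \<notin> P"
    using incongruent_points by blast
  define T where "T c = {x \<in> S. poly f x - c \<in> P}" for c
  have "S = T 0 \<union> T 1"
    using assms(2) S(2) D_iff unfolding T_def by auto
  then obtain c where c: "c \<in> {0, 1}" "infinite (T c)"
    using S(1) by auto
  then have "c \<in> V" using subring_zero[OF V] subring_one[OF V] by auto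
  have "coeffs_in P (f - [:c:])"
  proof (rule coeffs_in_ideal_if_roots[OF _ c(2)])
    show "coeffs_in V (f - [:c:])"
      using assms(1) \<open>c \<in> V\<close> by (intro coeffs_in_diff coeffs_in_const V)
  qed (use S in \<open>auto simp: T_def\<close>)
  then have "coeff (f - [:c:]) i \<in> P" unfolding coeffs_in_def by blast
  then show ?thesis using \<open>0 < i\<close> by (simp add: coeff_pCons split: nat.splits)
qed

lemma common_denominator:
  "coeffs_in (quotient_field V) g \<Longrightarrow> \<exists>k. coeffs_in V (smult (p ^ k) g)"
proof (induction g)
  case 0
  then show ?case using subring_zero[OF V] by (simp add: coeffs_in_def)
next
  case (pCons a g)
  then have "a \<in> quotient_field V" "coeffs_in (quotient_field V) g"
    by (simp_all add: coeffs_in_pCons)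
  then obtain k l where k: "p ^ k * a \<in> V" and l: "coeffs_in V (smult (p ^ l) g)"
    using clears_denominators pCons.IH by blast
  have "p ^ l * (p ^ k * a) \<in> V" "coeffs_in V (smult (p ^ k) (smult (p ^ l) g))"
    by (intro subring_mult subring_power coeffs_in_smult V k l p)+
  then have "coeffs_in V (smult (p ^ (k + l)) (pCons a g))"
    by (simp add: coeffs_in_pCons power_add mult_ac)
  then show ?case by blast
qed

text \<open>
  A common denominator \<open>p^k\<close> can be removed one factor at a time: as long as \<open>p^k g\<close> has
  coefficients in \<open>V\<close>, it is also \<open>D\<close>-valued, so its nonconstant coefficients are divisible by
  \<open>p\<close>.
\<close>

lemma coeffs_of_D_valued:
  assumes "coeffs_in (quotient_field V) g" and gD: "\<And>x. x \<in> V \<Longrightarrow> poly g x \<in> D"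
  shows "coeff g 0 \<in> D" "0 < i \<Longrightarrow> coeff g i \<in> P"
proof -
  show g0: "coeff g 0 \<in> D"
    using gD[OF subring_zero[OF V]] by (simp add: poly_0_coeff_0)
  have descent: "coeffs_in V (smult (p ^ k) g) \<Longrightarrow> 0 < i \<Longrightarrow> coeff g i \<in> P" for k i
  proof (induction k)
    case 0
    then show ?case using two_valued_mod_ideal[of g] gD by simp
  next
    case (Suc k)
    have val: "poly (smult (p ^ Suc k) g) x \<in> D" if "x \<in> V" for x
    proof -
      have "p * (p ^ k * poly g x) \<in> P"
        by (intro ideal_mult_generator subring_mult subring_power V p subsetD[OF D_subset] gD that)
      then show ?thesis by (simp add: D_iff mult.assoc)
    qed
    have "coeff (smult (p ^ k) g) j \<in> V" for j
    proof (cases "j = 0")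
      case True
      then show ?thesis
        using subsetD[OF D_subset g0] subring_mult[OF V subring_power[OF V p(1)]] by simp
    next
      case False
      then have "coeff (smult (p ^ Suc k) g) j \<in> P"
        using two_valued_mod_ideal[OF Suc.prems(1) val] by blast
      then show ?thesis
        using p(2) by (elim ideal_generatorE) (simp add: mult.assoc)
    qed
    then show ?case using Suc by (simp add: coeffs_in_def)
  qed
  obtain k where "coeffs_in V (smult (p ^ k) g)"
    using common_denominator[OF assms(1)] by blast
  then show "0 < i \<Longrightarrow> coeff g i \<in> P" using descent by blast
qed

end

section \<open>Evaluation at rational functions\<close>

lemma
  fixes x y :: "'a::field"
  shows ratfun_const_0: "ratfun_const (0::'a) = 0"
    and ratfun_const_1: "ratfun_const (1::'a) = 1"
    and ratfun_const_add: "ratfun_const (x + y) = ratfun_const x + ratfun_const y"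
    and ratfun_const_diff: "ratfun_const (x - y) = ratfun_const x - ratfun_const y"
    and ratfun_const_mult: "ratfun_const (x * y) = ratfun_const x * ratfun_const y"
    and ratfun_const_eq_0_iff: "ratfun_const x = 0 \<longleftrightarrow> x = 0"
  unfolding ratfun_const_def
  by (simp_all flip: to_fract_add to_fract_diff to_fract_mult to_fract_1 add: one_pCons)

lemma ratfun_const_divide: "ratfun_const (x / y) = ratfun_const x / ratfun_const y"
proof (cases "y = 0")
  case False
  then have "ratfun_const (x / y) * ratfun_const y = ratfun_const x"
    by (simp flip: ratfun_const_mult)
  then show ?thesis using False by (simp add: field_simps ratfun_const_eq_0_iff)
qed (simp add: ratfun_const_0)

lemma ratfun_const_sum: "ratfun_const (sum f I) = (\<Sum>i\<in>I. ratfun_const (f i))"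
  by (induction I rule: infinite_finite_induct) (simp_all add: ratfun_const_0 ratfun_const_add)

lemma map_poly_ratfun_const_mult:
  "map_poly ratfun_const (q * r) = map_poly ratfun_const q * map_poly ratfun_const r"
  by (rule poly_eqI)
     (simp add: coeff_map_poly ratfun_const_0 coeff_mult ratfun_const_sum ratfun_const_mult)

lemma map_poly_ratfun_const_power:
  "map_poly ratfun_const (q ^ n) = map_poly ratfun_const q ^ n"
  by (induction n) (simp_all add: map_poly_ratfun_const_mult ratfun_const_1)

lemma map_poly_ratfun_const_sum:
  "map_poly ratfun_const (sum f I) = (\<Sum>i\<in>I. map_poly ratfun_const (f i))"
  by (rule poly_eqI)
     (simp add: coeff_map_poly ratfun_const_0 coeff_sum ratfun_const_sum)

lemma keys_mpoly_const: "Poly_Mapping.keys (mpoly_const F) = Poly_Mapping.keys F"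
  unfolding mpoly_const_def
  by (auto simp: in_keys_iff Poly_Mapping.map.rep_eq when_def ratfun_const_eq_0_iff)

lemma lookup_mpoly_const:
  "Poly_Mapping.lookup (mpoly_const F) m = ratfun_const (Poly_Mapping.lookup F m)"
  unfolding mpoly_const_def by (simp add: Poly_Mapping.map.rep_eq when_def ratfun_const_0)

lemma mpoly_const_in_mpolynomials:
  assumes "ratfun_const ` R \<subseteq> S" "F \<in> mpolynomials (quotient_field R) n"
  shows "mpoly_const F \<in> mpolynomials (quotient_field S) n"
proof -
  have "ratfun_const x \<in> quotient_field S" if x: "x \<in> quotient_field R" for x
  proof -
    obtain a b where ab: "a \<in> R" "b \<in> R" "b \<noteq> 0" "x = a / b"
      using x unfolding quotient_field_def by blast
    then have "ratfun_const a \<in> S" "ratfun_const b \<in> S" "ratfun_const b \<noteq> 0"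
      using assms(1) unfolding ratfun_const_eq_0_iff by blast+
    then show ?thesis
      unfolding ab(4) ratfun_const_divide by (rule divide_in_quotient_field)
  qed
  then show ?thesis
    using assms(2) unfolding mpolynomials_def keys_mpoly_const lookup_mpoly_const mem_Collect_eq
    by blast
qed

text \<open>
  The univariate polynomial \<open>F(c + p X)\<close>, for \<open>F\<close> involving only the variable \<open>Z_0\<close>.
\<close>

definition affine_substitution :: "'a::field mpolynomial \<Rightarrow> 'a \<Rightarrow> 'a \<Rightarrow> 'a poly" where
  "affine_substitution F c p =
     (\<Sum>m\<in>Poly_Mapping.keys F. smult (Poly_Mapping.lookup F m) ([:c, p:] ^ Poly_Mapping.lookup m 0))"

lemma univariate_monomial:
  fixes m :: "nat \<Rightarrow>\<^sub>0 nat"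
  assumes "Poly_Mapping.keys m \<subseteq> {..<1}"
  shows "(\<Prod>i\<in>Poly_Mapping.keys m. z i ^ Poly_Mapping.lookup m i) = z 0 ^ Poly_Mapping.lookup m 0"
proof -
  have "x = 0" if "x \<in> Poly_Mapping.keys m" for x
    using subsetD[OF assms that] by simp
  then consider "Poly_Mapping.keys m = {0}" | "Poly_Mapping.keys m = {}"
    by blast
  then show ?thesis
  proof cases
    case 1
    then show ?thesis by simp
  next
    case 2
    then have "Poly_Mapping.lookup m 0 = 0" by simp
    then show ?thesis by (simp add: 2)
  qed
qed

lemma poly_affine_substitution:
  assumes "F \<in> mpolynomials K 1"
  shows "poly (affine_substitution F c p) x = mpoly_eval F (\<lambda>_. c + p * x)"
proof -
  have "Poly_Mapping.keys m \<subseteq> {..<1}" if "m \<in> Poly_Mapping.keys F" for m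
    using assms that unfolding mpolynomials_def by blast
  then show ?thesis
    unfolding affine_substitution_def mpoly_eval_def poly_sum
    by (intro sum.cong refl) (simp add: univariate_monomial mult.commute)
qed

text \<open>
  This reduces evaluation at the rational function \<open>c + p t\<close> to the polynomial \<open>F(c + p X)\<close>,
  whose coefficients lie in the base field.
\<close>

lemma mpoly_const_affine_substitution:
  assumes "F \<in> mpolynomials K 1" and z: "z 0 = ratfun_const c + ratfun_const p * t"
  shows "mpoly_eval (mpoly_const F) z = poly (map_poly ratfun_const (affine_substitution F c p)) t"
proof -
  have "poly (map_poly ratfun_const (affine_substitution F c p)) t =
    (\<Sum>m\<in>Poly_Mapping.keys F. ratfun_const (Poly_Mapping.lookup F m) * z 0 ^ Poly_Mapping.lookup m 0)"
    unfolding affine_substitution_def z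
    by (simp add: map_poly_ratfun_const_sum map_poly_smult map_poly_ratfun_const_power
        ratfun_const_0 ratfun_const_mult map_poly_pCons poly_sum mult.commute)
  also have "\<dots> = mpoly_eval (mpoly_const F) z"
    unfolding mpoly_eval_def keys_mpoly_const lookup_mpoly_const
  proof (intro sum.cong refl)
    fix m assume "m \<in> Poly_Mapping.keys F"
    then have "Poly_Mapping.keys m \<subseteq> {..<1}"
      using assms(1) unfolding mpolynomials_def by blast
    then show "ratfun_const (Poly_Mapping.lookup F m) * z 0 ^ Poly_Mapping.lookup m 0 =
        ratfun_const (Poly_Mapping.lookup F m) * (\<Prod>i\<in>Poly_Mapping.keys m. z i ^ Poly_Mapping.lookup m i)"
      by (simp only: univariate_monomial)
  qed
  finally show ?thesis by simp
qed

section \<open>A module closed under powers but not under multiplication\<close>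

lemma add_self_char2: "(1::'a::comm_ring_1) + 1 = 0 \<Longrightarrow> (x::'a) + x = 0"
  by (metis distrib_right mult_1 mult_zero_left)

text \<open>
  The off-diagonal terms of the square occur in pairs and cancel.
\<close>

lemma coeff_square_char2:
  fixes q :: "'a::comm_ring_1 poly"
  assumes "(1::'a) + 1 = 0"
  shows "coeff (q * q) n = (if even n then (coeff q (n div 2))\<^sup>2 else 0)"
proof (induction q arbitrary: n)
  case 0
  then show ?case by simp
next
  case (pCons a q)
  have "smult a q + smult a q = 0"
    by (intro poly_eqI) (simp only: coeff_add add_self_char2[OF assms] coeff_0)
  then have "pCons a q * pCons a q = pCons (a * a) (pCons 0 (q * q))"
    by (simp add: algebra_simps)
  then show ?case
    using pCons.IH by (auto simp: coeff_pCons power2_eq_square split: nat.splits)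
qed

lemma coeff_coeff_mult:
  "coeff (coeff (F * G) i) j =
     (\<Sum>a\<le>i. \<Sum>b\<le>j. coeff (coeff F a) b * coeff (coeff G (i - a)) (j - b))"
  by (simp add: coeff_mult coeff_sum)

context infinite_residue_dvr
begin

text \<open>
  The outer variable of \<open>'k poly poly\<close> is \<open>y\<close> and the inner one is \<open>x\<close>. Modulo \<open>p\<close>, this is the
  module generated by \<open>1\<close>, \<open>x\<close>, \<open>y\<close> over the polynomials in \<open>x^2\<close> and \<open>y^2\<close>.
\<close>

definition J :: "'k poly poly set" where
  "J = {G. \<forall>i j. coeff (coeff G i) j \<in> V \<and> (odd i \<and> odd j \<longrightarrow> coeff (coeff G i) j \<in> P)}"

lemma J_diff: "G \<in> J \<Longrightarrow> H \<in> J \<Longrightarrow> G - H \<in> J"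
  unfolding J_def by (simp add: subring_diff[OF V] ideal_diff)

lemma J_zero: "0 \<in> J"
  unfolding J_def by (simp add: subring_zero[OF V] ideal_zero)

lemma J_add: "G \<in> J \<Longrightarrow> H \<in> J \<Longrightarrow> G + H \<in> J"
  unfolding J_def by (simp add: subring_add[OF V] ideal_add)

lemma J_sum: "(\<And>i. i \<in> I \<Longrightarrow> f i \<in> J) \<Longrightarrow> sum f I \<in> J"
  by (induction I rule: infinite_finite_induct) (simp_all add: J_zero J_add)

lemma J_const: "x \<in> V \<Longrightarrow> [:[:x:]:] \<in> J"
  unfolding J_def using subring_zero[OF V] ideal_zero by (simp add: coeff_pCons split: nat.splits)

lemma J_smult: "x \<in> V \<Longrightarrow> G \<in> J \<Longrightarrow> [:[:x:]:] * G \<in> J"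
  unfolding J_def by (simp add: subring_mult[OF V] ideal_mult_left)

text \<open>
  Products of elements of \<open>J\<close> need not lie in \<open>J\<close>, but \<open>p\<close> times any polynomial over \<open>V\<close> does.
  This is what makes \<open>{0, 1} + p J\<close> closed under multiplication.
\<close>

lemma J_mult:
  assumes "G \<in> J" "H \<in> J"
  shows "[:[:p:]:] * (G * H) \<in> J"
proof -
  have "coeff (coeff (G * H) i) j \<in> V" for i j
    unfolding coeff_coeff_mult using assms
    by (intro subring_sum[OF V] subring_mult[OF V]) (auto simp: J_def)
  then show ?thesis
    unfolding J_def using subring_mult[OF V p(1)] ideal_mult_generator by simp
qed

text \<open>
  A nonzero term of \<open>G^2\<close> has even exponents, so a monomial with odd exponents in the product
  can only arise from a monomial with odd exponents in \<open>H\<close>. The same argument would not apply to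
  a product of two unrelated elements, such as \<open>x\<close> and \<open>y\<close>.
\<close>

lemma J_square_mult:
  assumes "G \<in> J" "H \<in> J"
  shows "G * G * H \<in> J"
proof -
  have one_plus_one_poly: "(1::'k poly) + 1 = 0"
    using one_plus_one by (simp add: one_pCons)
  have sq: "coeff (coeff (G * G) i) j =
      (if even i \<and> even j then (coeff (coeff G (i div 2)) (j div 2))\<^sup>2 else 0)" for i j
    unfolding coeff_square_char2[OF one_plus_one_poly] power2_eq_square[of "coeff G _"]
    by (simp add: coeff_square_char2[OF one_plus_one])
  then have sqV: "coeff (coeff (G * G) i) j \<in> V" for i j
    using assms(1) subring_zero[OF V] subring_power[OF V] by (simp add: J_def)
  have HV: "coeff (coeff H i) j \<in> V" for i j
    using assms(2) by (simp add: J_def)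
  have "coeff (coeff (G * G * H) i) j \<in> V" for i j
    unfolding coeff_coeff_mult[of "G * G"]
    by (intro subring_sum[OF V] subring_mult[OF V] sqV HV)
  moreover have "coeff (coeff (G * G * H) i) j \<in> P" if "odd i" "odd j" for i j
    unfolding coeff_coeff_mult[of "G * G"]
  proof (intro ideal_sum)
    fix a b assume "a \<in> {..i}" "b \<in> {..j}"
    show "coeff (coeff (G * G) a) b * coeff (coeff H (i - a)) (j - b) \<in> P"
    proof (cases "even a \<and> even b")
      case True
      then have "odd (i - a)" "odd (j - b)"
        using that \<open>a \<in> {..i}\<close> \<open>b \<in> {..j}\<close> by auto
      then show ?thesis
        using assms(2) sqV by (intro ideal_mult_left) (auto simp: J_def)
    next
      case False
      then show ?thesis using sq ideal_zero by auto
    qed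
  qed
  ultimately show ?thesis unfolding J_def by blast
qed

lemma J_power: "G \<in> J \<Longrightarrow> G ^ n \<in> J"
proof (induction n rule: induct_nat_012)
  case 0
  then show ?case using J_const[OF subring_one[OF V]] by (simp add: one_pCons)
next
  case (ge2 n)
  then show ?case using J_square_mult[of G "G ^ n"] by (simp add: mult.assoc)
qed simp

definition A :: "'k poly poly fract set" where
  "A = {ratfun_const c + ratfun_const p * to_fract G | c G. c \<in> {0, 1} \<and> G \<in> J}"

lemma A_I: "c \<in> {0, 1} \<Longrightarrow> G \<in> J \<Longrightarrow> ratfun_const c + ratfun_const p * to_fract G \<in> A"
  unfolding A_def by blast

lemma subring_A: "subring_of_field A"
  unfolding subring_of_field_def
proof (intro conjI ballI)
  show "1 \<in> A" using A_I[of 1 0] J_zero by (simp add: ratfun_const_1)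
next
  fix x y assume "x \<in> A" "y \<in> A"
  then obtain c G d H where c: "c \<in> {0, 1}" "G \<in> J" "x = ratfun_const c + ratfun_const p * to_fract G"
    and d: "d \<in> {0, 1}" "H \<in> J" "y = ratfun_const d + ratfun_const p * to_fract H"
    unfolding A_def by blast
  have neg: "- 1 = (1::'k)" using one_plus_one by (simp add: eq_neg_iff_add_eq_0 eq_commute)
  have "x - y = ratfun_const (c - d) + ratfun_const p * to_fract (G - H)"
    using c d by (simp add: ratfun_const_diff algebra_simps)
  moreover have "c - d \<in> {0, 1}" using c d neg by auto
  ultimately show "x - y \<in> A" using A_I[of "c - d" "G - H"] J_diff c d by simp
  \<comment> \<open>\<open>E\<close> collects the terms of \<open>(c + p G) (d + p H)\<close> that are divisible by \<open>p\<close>.\<close>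
  define E where "E = [:[:c:]:] * H + [:[:d:]:] * G + [:[:p:]:] * (G * H)"
  have "c \<in> V" "d \<in> V" using c d subring_zero[OF V] subring_one[OF V] by auto
  then have "E \<in> J" unfolding E_def by (intro J_add J_smult J_mult c d)
  moreover have "x * y = ratfun_const (c * d) + ratfun_const p * to_fract E"
    unfolding c d E_def to_fract_add to_fract_mult ratfun_const_mult ratfun_const_def[symmetric]
    by (simp add: algebra_simps)
  moreover have "c * d \<in> {0, 1}" using c d by auto
  ultimately show "x * y \<in> A" using A_I[of "c * d" E] by simp
qed

lemma D_subset_A: "ratfun_const ` D \<subseteq> A"
proof
  fix z assume "z \<in> ratfun_const ` D"
  then obtain c x where cx: "c \<in> {0, 1}" "x \<in> V" "z = ratfun_const (c + p * x)"
    unfolding F2_plus_def principal_ideal_def by blast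
  then have "z = ratfun_const c + ratfun_const p * to_fract [:[:x:]:]"
    by (simp add: ratfun_const_add ratfun_const_mult flip: ratfun_const_def)
  then show "z \<in> A" using A_I[OF cx(1) J_const[OF cx(2)]] by simp
qed

text \<open>
  The value is a \<open>V\<close>-linear combination of powers of a single element of \<open>J\<close>.
\<close>

lemma poly_at_J:
  assumes "coeffs_in V q" "G \<in> J"
  shows "\<exists>H\<in>J. poly (map_poly ratfun_const q) (to_fract G) = to_fract H"
proof -
  define H where "H = (\<Sum>i\<le>degree (map_poly ratfun_const q). [:[:coeff q i:]:] * G ^ i)"
  have tp: "to_fract (G ^ i) = to_fract G ^ i" for i
    by (induction i) simp_all
  have "poly (map_poly ratfun_const q) (to_fract G) = to_fract H"
    unfolding H_def to_fract_sum to_fract_mult tp poly_altdef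
    by (simp add: coeff_map_poly ratfun_const_0 flip: ratfun_const_def)
  moreover have "H \<in> J"
    unfolding H_def using assms by (intro J_sum J_smult J_power) (auto simp: coeffs_in_def)
  ultimately show ?thesis by blast
qed

text \<open>
  The polynomial \<open>F(c + p X)\<close> maps \<open>V\<close> into \<open>D\<close>, so the description of \<open>D\<close>-valued polynomials
  applies to it.
\<close>

lemma int_valued_affine_substitution:
  assumes F: "F \<in> int_valued D 1" and c: "c \<in> {0, 1}"
  obtains d q where "d \<in> {0, 1}" "coeffs_in V q" "affine_substitution F c p = [:d:] + smult p q"
proof -
  define g where "g = affine_substitution F c p"
  have FQ: "F \<in> mpolynomials (quotient_field D) 1"
    using F unfolding int_valued_def by blast
  have VQ: "x \<in> quotient_field V" if "x \<in> V" for x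
    using that subring_subset_quotient_field[OF V] by blast
  have "c \<in> V" using c subring_zero[OF V] subring_one[OF V] by auto
  have "coeffs_in (quotient_field V) [:c, p:]"
    using VQ[OF \<open>c \<in> V\<close>] VQ[OF p(1)] VQ[OF subring_zero[OF V]]
    by (simp add: coeffs_in_pCons) (simp add: coeffs_in_def)
  moreover have "Poly_Mapping.lookup F m \<in> quotient_field V" if "m \<in> Poly_Mapping.keys F" for m
    using FQ that quotient_field_mono[OF D_subset] unfolding mpolynomials_def by blast
  ultimately have gQ: "coeffs_in (quotient_field V) g"
    unfolding g_def affine_substitution_def
    by (intro coeffs_in_sum coeffs_in_smult coeffs_in_power subring_quotient_field V)
  have gD: "poly g x \<in> D" if "x \<in> V" for x
  proof -
    have "c + p * x \<in> D"
      unfolding F2_plus_def principal_ideal_def using that c by blast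
    moreover have "\<forall>z. (\<forall>i<1. z i \<in> D) \<longrightarrow> mpoly_eval F z \<in> D"
      using F unfolding int_valued_def by blast
    ultimately show ?thesis
      unfolding g_def poly_affine_substitution[OF FQ] by simp
  qed
  obtain d where d: "d \<in> {0, 1}" "coeff g 0 - d \<in> P"
    using coeffs_of_D_valued(1)[OF gQ gD] F2_plus_altdef[OF V p(1)] by blast
  define q where "q = smult (1 / p) (g - [:d:])"
  have "coeff (g - [:d:]) i \<in> P" for i
    using d(2) coeffs_of_D_valued(2)[OF gQ gD, of i]
    by (cases i) auto
  then have "coeff (g - [:d:]) i / p \<in> V" for i
    using p(2) by (metis ideal_generatorE nonzero_mult_div_cancel_left)
  then have "coeffs_in V q"
    unfolding coeffs_in_def q_def by simp
  moreover have "g = [:d:] + smult p q"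
    unfolding q_def using p by simp
  ultimately show ?thesis using that d(1) unfolding g_def by blast
qed

lemma int_valued_subset: "mpoly_const ` int_valued D 1 \<subseteq> int_valued A 1"
proof
  fix F' assume "F' \<in> mpoly_const ` int_valued D 1"
  then obtain F where F: "F \<in> int_valued D 1" "F' = mpoly_const F" by blast
  then have FQ: "F \<in> mpolynomials (quotient_field D) 1" unfolding int_valued_def by blast
  have "mpoly_eval F' z \<in> A" if z: "\<forall>i<1. z i \<in> A" for z
  proof -
    obtain c G where c: "c \<in> {0, 1}" "G \<in> J" "z 0 = ratfun_const c + ratfun_const p * to_fract G"
      using z unfolding A_def by auto
    obtain d q where d: "d \<in> {0, 1}" "coeffs_in V q" "affine_substitution F c p = [:d:] + smult p q"
      using int_valued_affine_substitution[OF F(1) c(1)] .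
    obtain H where H: "H \<in> J" "poly (map_poly ratfun_const q) (to_fract G) = to_fract H"
      using poly_at_J[OF d(2) c(2)] by blast
    have "map_poly ratfun_const ([:d:] + smult p q) =
        [:ratfun_const d:] + smult (ratfun_const p) (map_poly ratfun_const q)"
      by (rule poly_eqI)
         (simp add: coeff_map_poly coeff_pCons ratfun_const_0 ratfun_const_add ratfun_const_mult
           split: nat.splits)
    then have "mpoly_eval F' z = ratfun_const d + ratfun_const p * to_fract H"
      unfolding F(2) mpoly_const_affine_substitution[where z = z, OF FQ c(3)] d(3) by (simp add: H(2))
    then show ?thesis using A_I[OF d(1) H(1)] by simp
  qed
  then show "F' \<in> int_valued A 1"
    using mpoly_const_in_mpolynomials[OF D_subset_A FQ] unfolding int_valued_def F(2) by blast
qed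

end

section \<open>An integer-valued polynomial in two variables\<close>

definition bivariate_monomial :: "nat \<times> nat \<Rightarrow> nat \<Rightarrow>\<^sub>0 nat" where
  "bivariate_monomial = (\<lambda>(i, j). Poly_Mapping.single 0 i + Poly_Mapping.single 1 j)"

text \<open>
  The polynomial \<open>c (Z_0 + Z_0^2) (Z_1 + Z_1^2)\<close>, given by its four monomials. In characteristic
  2, the factors \<open>Z + Z^2\<close> are Artin-Schreier polynomials, which vanish at 0 and 1.
\<close>

definition artin_schreier_product :: "'a::field \<Rightarrow> 'a mpolynomial" where
  "artin_schreier_product c =
     (\<Sum>m\<in>bivariate_monomial ` ({1, 2} \<times> {1, 2}). Poly_Mapping.single m c)"

lemma lookup_bivariate_monomial:
  "Poly_Mapping.lookup (bivariate_monomial (i, j)) k = (if k = 0 then i else if k = 1 then j else 0)"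
  by (simp add: bivariate_monomial_def lookup_add lookup_single when_def)

lemma inj_bivariate_monomial: "inj bivariate_monomial"
proof (rule injI)
  fix a b assume eq: "bivariate_monomial a = bivariate_monomial b"
  obtain i j where a: "a = (i, j)" by (cases a)
  obtain k l where b: "b = (k, l)" by (cases b)
  have "Poly_Mapping.lookup (bivariate_monomial (i, j)) n = Poly_Mapping.lookup (bivariate_monomial (k, l)) n" for n
    using eq a b by simp
  from this[of 0] this[of 1] show "a = b"
    by (simp add: lookup_bivariate_monomial a b)
qed

lemma keys_bivariate_monomial: "Poly_Mapping.keys (bivariate_monomial (Suc i, Suc j)) = {0, 1}"
  by (auto simp: in_keys_iff lookup_bivariate_monomial split: if_splits)

lemma lookup_artin_schreier_product:
  "Poly_Mapping.lookup (artin_schreier_product c) m =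
     (if m \<in> bivariate_monomial ` ({1, 2} \<times> {1, 2}) then c else 0)"
  unfolding artin_schreier_product_def by (simp add: lookup_sum lookup_single when_def)

lemma keys_artin_schreier_product:
  "c \<noteq> 0 \<Longrightarrow> Poly_Mapping.keys (artin_schreier_product c) = bivariate_monomial ` ({1, 2} \<times> {1, 2})"
  by (intro set_eqI) (simp only: in_keys_iff lookup_artin_schreier_product split: if_split, simp)

lemma sum_bivariate_monomials:
  fixes c :: "'a::field"
  shows "(\<Sum>m\<in>bivariate_monomial ` ({1, 2} \<times> {1, 2}).
      c * (\<Prod>i\<in>Poly_Mapping.keys m. z i ^ Poly_Mapping.lookup m i)) =
    c * ((z 0 + (z 0)\<^sup>2) * (z 1 + (z 1)\<^sup>2))"
proof -
  have monomial: "(\<Prod>k\<in>Poly_Mapping.keys (bivariate_monomial (i, j)).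
      z k ^ Poly_Mapping.lookup (bivariate_monomial (i, j)) k) = z 0 ^ i * z 1 ^ j"
    if ij: "i \<in> {1, 2}" "j \<in> {1, 2}" for i j
  proof -
    obtain i' j' where "i = Suc i'" "j = Suc j'"
      using ij not0_implies_Suc[of i] not0_implies_Suc[of j] by auto
    then show ?thesis using keys_bivariate_monomial[of i' j'] by (simp add: lookup_bivariate_monomial)
  qed
  have "(\<Sum>m\<in>bivariate_monomial ` ({1, 2} \<times> {1, 2}).
      c * (\<Prod>i\<in>Poly_Mapping.keys m. z i ^ Poly_Mapping.lookup m i)) =
    (\<Sum>(i, j)\<in>{1, 2} \<times> {1, 2}. c * (z 0 ^ i * z 1 ^ j))"
    by (subst sum.reindex[OF inj_on_subset[OF inj_bivariate_monomial subset_UNIV]])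
       (auto intro!: sum.cong simp: monomial)
  also have "\<dots> = (\<Sum>i\<in>{1, 2}. \<Sum>j\<in>{1, 2}. c * (z 0 ^ i * z 1 ^ j))"
    by (simp add: sum.cartesian_product)
  also have "\<dots> = c * ((z 0 + (z 0)\<^sup>2) * (z 1 + (z 1)\<^sup>2))"
    by (simp add: algebra_simps)
  finally show ?thesis .
qed

lemma eval_artin_schreier_product:
  assumes "c \<noteq> 0"
  shows "mpoly_eval (artin_schreier_product c) z = c * ((z 0 + (z 0)\<^sup>2) * (z 1 + (z 1)\<^sup>2))"
  unfolding mpoly_eval_def keys_artin_schreier_product[OF assms] sum_bivariate_monomials[symmetric]
  by (intro sum.cong refl) (simp add: lookup_artin_schreier_product)

lemma eval_const_artin_schreier_product:
  assumes "c \<noteq> 0"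
  shows "mpoly_eval (mpoly_const (artin_schreier_product c)) z =
    ratfun_const c * ((z 0 + (z 0)\<^sup>2) * (z 1 + (z 1)\<^sup>2))"
  unfolding mpoly_eval_def keys_mpoly_const lookup_mpoly_const keys_artin_schreier_product[OF assms]
    sum_bivariate_monomials[symmetric]
  by (intro sum.cong refl) (simp add: lookup_artin_schreier_product)

context infinite_residue_dvr
begin

lemma artin_schreier_in_ideal:
  assumes "x \<in> D"
  shows "x + x\<^sup>2 \<in> P"
proof -
  have eq: "x + x\<^sup>2 = x * (x + 1)" by (simp add: power2_eq_square algebra_simps)
  have "- 1 = (1::'k)"
    using one_plus_one by (rule minus_unique)
  then have sub: "x - 1 = x + 1" by (metis diff_conv_add_uminus)
  have "x \<in> V" using assms D_subset by blast
  moreover have "x + 1 \<in> V" using \<open>x \<in> V\<close> by (intro subring_add subring_one V)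
  ultimately show ?thesis
    using assms ideal_mult_left[of x "x + 1"] ideal_mult_left[of "x + 1" x]
    unfolding eq D_iff sub by (auto simp: mult.commute)
qed

lemma artin_schreier_product_int_valued:
  assumes "2 \<le> n"
  shows "artin_schreier_product (1 / p) \<in> int_valued D n"
proof -
  have "1 \<in> D" "p \<in> D"
    using ideal_zero ideal_mult_generator[OF subring_one[OF V]] by (simp_all add: D_iff)
  then have "1 / p \<in> quotient_field D" using p by (intro divide_in_quotient_field)
  moreover have "Poly_Mapping.keys m \<subseteq> {..<n}"
    if m: "m \<in> bivariate_monomial ` ({1, 2} \<times> {1, 2})" for m
  proof
    fix k assume "k \<in> Poly_Mapping.keys m"
    then have "k = 0 \<or> k = 1" using m by (auto simp: in_keys_iff lookup_bivariate_monomial split: if_splits)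
    then show "k \<in> {..<n}" using assms by auto
  qed
  ultimately have "artin_schreier_product (1 / p) \<in> mpolynomials (quotient_field D) n"
    using keys_artin_schreier_product[of "1 / p"] p(2)
    by (auto simp: mpolynomials_def lookup_artin_schreier_product)
  moreover have "mpoly_eval (artin_schreier_product (1 / p)) z \<in> D" if z: "\<forall>i<n. z i \<in> D" for z
  proof -
    have "z 0 + (z 0)\<^sup>2 \<in> P" "z 1 + (z 1)\<^sup>2 \<in> P"
      using z assms by (auto intro!: artin_schreier_in_ideal)
    then obtain a b where "a \<in> V" "z 0 + (z 0)\<^sup>2 = p * a" "b \<in> V" "z 1 + (z 1)\<^sup>2 = p * b"
      unfolding principal_ideal_def by blast
    then have "mpoly_eval (artin_schreier_product (1 / p)) z = p * (a * b)" "a * b \<in> V"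
      using p(2) subring_mult[OF V] by (simp_all add: eval_artin_schreier_product)
    then show ?thesis using ideal_mult_generator by (simp add: D_iff)
  qed
  ultimately show ?thesis unfolding int_valued_def by blast
qed

lemma artin_schreier_product_not_int_valued:
  assumes "2 \<le> n"
  shows "mpoly_const (artin_schreier_product (1 / p)) \<notin> int_valued A n"
proof
  assume iv: "mpoly_const (artin_schreier_product (1 / p)) \<in> int_valued A n"
  \<comment> \<open>The test point is \<open>(p x, p y)\<close>; the variables from \<open>Z_2\<close> on are set to 0.\<close>
  define X Y :: "'k poly poly" where "X = [:[:0, 1:]:]" and "Y = [:0, 1:]"
  define z where "z i = (if i = (0::nat) then ratfun_const p * to_fract X
     else if i = 1 then ratfun_const p * to_fract Y else 0)" for i
  have "X \<in> J" "Y \<in> J"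
    unfolding X_def Y_def J_def using subring_zero[OF V] subring_one[OF V] ideal_zero
    by (auto simp: coeff_pCons one_pCons split: nat.splits)
  then have "ratfun_const p * to_fract X \<in> A" "ratfun_const p * to_fract Y \<in> A"
    using A_I[of 0 X] A_I[of 0 Y] by (simp_all add: ratfun_const_0)
  then have "z i \<in> A" for i
    using subring_zero[OF subring_A] by (simp add: z_def)
  then have value_in_A: "mpoly_eval (mpoly_const (artin_schreier_product (1 / p))) z \<in> A"
    using iv unfolding int_valued_def by blast
  define W where "W = [:[:p:]:] * ((X + [:[:p:]:] * X\<^sup>2) * (Y + [:[:p:]:] * Y\<^sup>2))"
  have "mpoly_eval (mpoly_const (artin_schreier_product (1 / p))) z =
    ratfun_const p * ((to_fract X + ratfun_const p * (to_fract X)\<^sup>2) *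
      (to_fract Y + ratfun_const p * (to_fract Y)\<^sup>2))"
    using p(2)
    by (simp add: eval_const_artin_schreier_product z_def ratfun_const_divide ratfun_const_1
        ratfun_const_eq_0_iff power2_eq_square field_simps)
  also have "\<dots> = to_fract W"
    by (simp only: W_def ratfun_const_def power2_eq_square to_fract_mult to_fract_add)
  finally have "to_fract W \<in> A"
    using value_in_A by simp
  then obtain c G where G: "G \<in> J" "to_fract W = ratfun_const c + ratfun_const p * to_fract G"
    unfolding A_def by auto
  then have "to_fract W = to_fract ([:[:c:]:] + [:[:p:]:] * G)"
    by (simp only: ratfun_const_def to_fract_add to_fract_mult)
  then have "W = [:[:c:]:] + [:[:p:]:] * G" by (simp only: to_fract_eq_iff)
  \<comment> \<open>In \<open>A\<close>, the coefficient at \<open>x y\<close> is \<open>p\<close> times an element of \<open>p V\<close>.\<close>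
  then have "coeff (coeff W 1) 1 = p * coeff (coeff G 1) 1"
    by simp
  moreover have "coeff (coeff W 1) 1 = p"
  proof -
    have X: "X + [:[:p:]:] * X\<^sup>2 = [:[:0, 1, p:]:]"
      unfolding X_def power2_eq_square by simp
    have Y: "Y + [:[:p:]:] * Y\<^sup>2 = [:0, 1, [:p:]:]"
      unfolding Y_def power2_eq_square by simp
    show ?thesis unfolding W_def X Y by simp
  qed
  ultimately have "coeff (coeff G 1) 1 = 1" using p(2) by simp
  moreover have "coeff (coeff G 1) 1 \<in> P"
    using G(1) unfolding J_def by simp
  ultimately show False using one_not_in_ideal by simp
qed

end

lemma overring_separating_int_valued:
  fixes V :: "'k::field set"
  assumes "CHAR('k) = 2" "discrete_valuation_domain V" "uniformizer V p" "infinite (residue_ring V p)"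
  shows "\<exists>A :: 'k poly poly fract set.
    subring_of_field A \<and> ratfun_const ` F2_plus V p \<subseteq> A \<and>
    mpoly_const ` int_valued (F2_plus V p) 1 \<subseteq> int_valued A 1 \<and>
    (\<forall>n\<ge>2. \<not> mpoly_const ` int_valued (F2_plus V p) n \<subseteq> int_valued A n)"
proof -
  interpret infinite_residue_dvr V p
    using assms by (rule infinite_residue_dvrI)
  show ?thesis
  proof (intro exI[of _ A] conjI allI impI notI)
    fix n :: nat
    assume "2 \<le> n" "mpoly_const ` int_valued (F2_plus V p) n \<subseteq> int_valued A n"
    then show False
      using artin_schreier_product_int_valued[of n] artin_schreier_product_not_int_valued[of n] by blast
  qed (fact subring_A D_subset_A int_valued_subset)+
qed

section \<open>The localization of a polynomial ring at the origin\<close>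

definition local_at_0 :: "'a::field poly fract set" where
  "local_at_0 = {to_fract f / to_fract g | f g. poly g 0 \<noteq> 0}"

text \<open>
  The order of vanishing at 0, computed from an arbitrary representation as a quotient; it has no
  meaning at the zero function.
\<close>

definition ord_at_0 :: "'a::field poly fract \<Rightarrow> int" where
  "ord_at_0 x = (SOME n. \<exists>f g. f \<noteq> 0 \<and> g \<noteq> 0 \<and> x = to_fract f / to_fract g \<and>
     n = int (order 0 f) - int (order 0 g))"

lemma fract_as_quotient:
  fixes x :: "'a::field poly fract"
  obtains f g where "g \<noteq> 0" "x = to_fract f / to_fract g"
  by (cases x rule: Fract_cases) (auto simp: Fract_conv_to_fract)

text \<open>
  Independence of the representation: cross-multiply and use additivity of the order.
\<close>

lemma ord_at_0_quotient:
  assumes "f \<noteq> 0" "g \<noteq> 0"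
  shows "ord_at_0 (to_fract f / to_fract g) = int (order 0 f) - int (order 0 g)"
  unfolding ord_at_0_def
proof (rule some_equality)
  show "\<exists>f' g'. f' \<noteq> 0 \<and> g' \<noteq> 0 \<and> to_fract f / to_fract g = to_fract f' / to_fract g' \<and>
    int (order 0 f) - int (order 0 g) = int (order 0 f') - int (order 0 g')"
    using assms by blast
next
  fix n assume "\<exists>f' g'. f' \<noteq> 0 \<and> g' \<noteq> 0 \<and> to_fract f / to_fract g = to_fract f' / to_fract g' \<and>
    n = int (order 0 f') - int (order 0 g')"
  then obtain f' g' where *: "f' \<noteq> 0" "g' \<noteq> 0" "to_fract f / to_fract g = to_fract f' / to_fract g'"
    "n = int (order 0 f') - int (order 0 g')" by blast
  then have "to_fract (f * g') = to_fract (f' * g)"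
    using assms by (simp add: frac_eq_eq)
  then have "f * g' = f' * g" by (simp only: to_fract_eq_iff)
  then have "order 0 (f * g') = order 0 (f' * g)" by simp
  then have "order 0 f + order 0 g' = order 0 f' + order 0 g"
    using assms * by (simp add: order_mult)
  then show "n = int (order 0 f) - int (order 0 g)" using * by linarith
qed

lemma quotient_field_local_at_0: "quotient_field (local_at_0 :: 'a::field poly fract set) = UNIV"
proof -
  have "x \<in> quotient_field local_at_0" for x :: "'a poly fract"
  proof -
    obtain f g where fg: "g \<noteq> 0" "x = to_fract f / to_fract g" by (rule fract_as_quotient)
    have "to_fract h \<in> local_at_0" for h :: "'a poly"
      unfolding local_at_0_def by (intro CollectI exI[of _ h] exI[of _ 1]) simp
    then show ?thesis
      unfolding fg(2) using fg(1) by (intro divide_in_quotient_field) simp_all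
  qed
  then show ?thesis by blast
qed

lemma subring_local_at_0: "subring_of_field local_at_0"
  unfolding subring_of_field_def
proof (intro conjI ballI)
  show "1 \<in> local_at_0" unfolding local_at_0_def by (intro CollectI exI[of _ 1]) simp
next
  fix x y :: "'a poly fract" assume "x \<in> local_at_0" "y \<in> local_at_0"
  then obtain f g f' g' where *: "poly g 0 \<noteq> 0" "x = to_fract f / to_fract g"
     "poly g' 0 \<noteq> 0" "y = to_fract f' / to_fract g'" unfolding local_at_0_def by blast
  then have nz: "g \<noteq> 0" "g' \<noteq> 0" by auto
  then have "x - y = to_fract (f * g' - f' * g) / to_fract (g * g')"
    "x * y = to_fract (f * f') / to_fract (g * g')"
    unfolding *(2,4) by (simp_all add: field_simps)
  moreover have "poly (g * g') 0 \<noteq> 0" using * by simp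
  ultimately show "x - y \<in> local_at_0" "x * y \<in> local_at_0"
    unfolding local_at_0_def by blast+
qed

lemma local_at_0_iff: "x \<in> local_at_0 \<longleftrightarrow> x = 0 \<or> 0 \<le> ord_at_0 x"
proof (cases "x = 0")
  case True
  then show ?thesis using subring_zero[OF subring_local_at_0] by simp
next
  case False
  show ?thesis
  proof
    assume "x \<in> local_at_0"
    then obtain f g where fg: "poly g 0 \<noteq> 0" "x = to_fract f / to_fract g"
      unfolding local_at_0_def by blast
    then have "f \<noteq> 0" "g \<noteq> 0" using False by auto
    then show "x = 0 \<or> 0 \<le> ord_at_0 x" using fg by (simp add: ord_at_0_quotient order_0I)
  next
    assume "x = 0 \<or> 0 \<le> ord_at_0 x"
    then have ord: "0 \<le> ord_at_0 x" using False by blast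
    obtain f g where fg: "g \<noteq> 0" "x = to_fract f / to_fract g" by (rule fract_as_quotient)
    then have "f \<noteq> 0" using False by auto
    then have le: "order 0 g \<le> order 0 f" using ord fg by (simp add: ord_at_0_quotient)
    define t :: "'a poly" where "t = [:0, 1:]"
    obtain f' where f': "f = t ^ order 0 f * f'"
      using order_decomp[OF \<open>f \<noteq> 0\<close>, of 0] unfolding t_def by auto
    obtain g' where g': "g = t ^ order 0 g * g'" "\<not> t dvd g'"
      using order_decomp[OF fg(1), of 0] unfolding t_def by auto
    have "t \<noteq> 0" "g' \<noteq> 0" using g' unfolding t_def by auto
    \<comment> \<open>Cancel the common power of \<open>t\<close>; the denominator then does not vanish at 0.\<close>
    have "f = t ^ order 0 g * (t ^ (order 0 f - order 0 g) * f')"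
      by (subst f') (simp add: le flip: mult.assoc power_add)
    then have "x = to_fract (t ^ order 0 g * (t ^ (order 0 f - order 0 g) * f')) / to_fract (t ^ order 0 g * g')"
      using fg(2) g'(1) by simp
    also have "\<dots> = to_fract (t ^ (order 0 f - order 0 g) * f') / to_fract g'"
      using \<open>t \<noteq> 0\<close> \<open>g' \<noteq> 0\<close> by (simp add: field_simps)
    finally have "x = to_fract (t ^ (order 0 f - order 0 g) * f') / to_fract g'" .
    moreover have "poly g' 0 \<noteq> 0" using g'(2) by (simp add: poly_eq_0_iff_dvd t_def)
    ultimately show "x \<in> local_at_0" unfolding local_at_0_def by blast
  qed
qed

lemma ord_at_0_to_fract: "f \<noteq> 0 \<Longrightarrow> ord_at_0 (to_fract f) = int (order 0 f)"
  using ord_at_0_quotient[of f 1] by simp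

lemma discrete_valuation_ord_at_0: "discrete_valuation_on UNIV (ord_at_0 :: 'a::field poly fract \<Rightarrow> int)"
  unfolding discrete_valuation_on_def
proof (intro conjI ballI impI)
  fix x y :: "'a poly fract" assume xy: "x \<in> UNIV - {0}" "y \<in> UNIV - {0}"
  obtain f g where fg: "g \<noteq> 0" "x = to_fract f / to_fract g" by (rule fract_as_quotient)
  obtain f' g' where fg': "g' \<noteq> 0" "y = to_fract f' / to_fract g'" by (rule fract_as_quotient)
  have nz: "f \<noteq> 0" "f' \<noteq> 0" using xy fg fg' by auto
  have "x * y = to_fract (f * f') / to_fract (g * g')" using fg fg' by simp
  then have "ord_at_0 (x * y) = int (order 0 (f * f')) - int (order 0 (g * g'))"
    using ord_at_0_quotient[of "f * f'" "g * g'"] nz fg fg' by simp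
  then show "ord_at_0 (x * y) = ord_at_0 x + ord_at_0 y"
    using fg fg' nz by (simp add: ord_at_0_quotient order_mult)
  assume "x + y \<noteq> 0"
  \<comment> \<open>Over a common denominator, the bound becomes one about divisibility by powers of \<open>t\<close>.\<close>
  define a b h where "a = f * g'" and "b = f' * g" and "h = g * g'"
  have abh: "a \<noteq> 0" "b \<noteq> 0" "h \<noteq> 0" using nz fg fg' by (auto simp: a_def b_def h_def)
  have x: "x = to_fract a / to_fract h" and y: "y = to_fract b / to_fract h"
    using fg(1) fg'(1) unfolding fg(2) fg'(2) by (simp_all add: a_def b_def h_def)
  then have sum: "x + y = to_fract (a + b) / to_fract h" by (simp add: add_divide_distrib)
  then have "a + b \<noteq> 0" using \<open>x + y \<noteq> 0\<close> by (metis to_fract_0 div_0)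
  define n where "n = min (order 0 a) (order 0 b)"
  have "[:- 0, 1:] ^ n dvd a" "[:- 0, 1:] ^ n dvd b"
    unfolding order_divides n_def by simp_all
  then have "[:- 0, 1:] ^ n dvd a + b" by (rule dvd_add)
  then have "n \<le> order 0 (a + b)" using \<open>a + b \<noteq> 0\<close> unfolding order_divides by blast
  then show "min (ord_at_0 x) (ord_at_0 y) \<le> ord_at_0 (x + y)"
    unfolding sum ord_at_0_quotient[OF \<open>a + b \<noteq> 0\<close> abh(3)]
    unfolding x y using abh by (simp add: ord_at_0_quotient n_def)
next
  have "n \<in> ord_at_0 ` (UNIV - {0 :: 'a poly fract})" for n
  proof -
    define t :: "'a poly" where "t = [:- 0, 1:]"
    have t: "t \<noteq> 0" "order 0 (t ^ k) = k" for k
      unfolding t_def by (simp, rule order_power_n_n)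
    \<comment> \<open>One of the two truncated exponents is 0, so this is the power \<open>t^n\<close> with integer exponent.\<close>
    define x where "x = to_fract (t ^ nat n) / to_fract (t ^ nat (- n))"
    have "ord_at_0 x = n"
      unfolding x_def using t by (subst ord_at_0_quotient) auto
    moreover have "x \<noteq> 0"
      unfolding x_def using t(1) by (metis divide_eq_0_iff power_not_zero to_fract_eq_0_iff)
    ultimately show ?thesis by blast
  qed
  then show "ord_at_0 ` (UNIV - {0 :: 'a poly fract}) = UNIV" by blast
qed

lemma discrete_valuation_domain_local_at_0: "discrete_valuation_domain local_at_0"
  unfolding discrete_valuation_domain_def quotient_field_local_at_0
  using subring_local_at_0 discrete_valuation_ord_at_0 local_at_0_iff by blast

lemma
  fixes t :: "'a::field poly fract"
  defines "t \<equiv> to_fract [:0, 1:]"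
  shows uniformizer_local_at_0: "uniformizer local_at_0 t"
    and principal_ideal_local_at_0:
      "principal_ideal local_at_0 t = {x \<in> local_at_0. x = 0 \<or> 1 \<le> ord_at_0 x}"
proof -
  have val: "subring_of_field (local_at_0 :: 'a poly fract set)"
    "discrete_valuation_on (quotient_field local_at_0) (ord_at_0 :: 'a poly fract \<Rightarrow> int)"
    "local_at_0 = {x \<in> quotient_field local_at_0. x = (0 :: 'a poly fract) \<or> 0 \<le> ord_at_0 x}"
    unfolding quotient_field_local_at_0
    using subring_local_at_0 discrete_valuation_ord_at_0 local_at_0_iff by auto
  have "order 0 [:- 0, 1 :: 'a:] = 1"
    using order_power_n_n[of "0 :: 'a" 1] by simp
  then have t: "t \<in> quotient_field local_at_0" "t \<noteq> 0" "ord_at_0 t = 1"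
    unfolding t_def quotient_field_local_at_0 by (simp_all add: ord_at_0_to_fract)
  show "uniformizer local_at_0 t"
    using uniformizer_iff_valuation[OF val] t by blast
  show "principal_ideal local_at_0 t = {x \<in> local_at_0. x = 0 \<or> 1 \<le> ord_at_0 x}"
    using principal_ideal_valuation_one[OF val t] .
qed

text \<open>
  The constants inject into the residue ring, since a nonzero constant has order 0.
\<close>

lemma infinite_residue_ring_local_at_0:
  assumes "infinite (UNIV :: 'a::field set)"
  shows "infinite (residue_ring local_at_0 (to_fract [:0, 1 :: 'a:]))"
proof -
  define t :: "'a poly fract" where "t = to_fract [:0, 1:]"
  define r where "r = {(x, y). x \<in> local_at_0 \<and> y \<in> local_at_0 \<and> x - y \<in> principal_ideal local_at_0 t}"
  define \<kappa> where "\<kappa> c = r `` {to_fract [:c:]}" for c :: 'a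
  have const: "to_fract [:c:] \<in> local_at_0" for c :: 'a
    unfolding local_at_0_def by (intro CollectI exI[of _ "[:c:]"] exI[of _ 1]) simp
  have "inj \<kappa>"
  proof (rule injI, rule ccontr)
    fix c d assume eq: "\<kappa> c = \<kappa> d" and "c \<noteq> d"
    have "to_fract [:c:] \<in> \<kappa> c"
      unfolding \<kappa>_def r_def t_def principal_ideal_local_at_0
      using const subring_zero[OF subring_local_at_0] by simp
    then have "to_fract [:d:] - to_fract [:c:] \<in> principal_ideal local_at_0 t"
      unfolding eq unfolding \<kappa>_def r_def by simp
    then have "to_fract [:d - c:] \<in> principal_ideal local_at_0 t"
      by (simp flip: to_fract_diff)
    moreover have "ord_at_0 (to_fract [:d - c:]) = 0"
      using \<open>c \<noteq> d\<close> by (simp add: ord_at_0_to_fract order_0I)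
    ultimately show False
      using \<open>c \<noteq> d\<close> unfolding t_def principal_ideal_local_at_0 by simp
  qed
  then have "infinite (range \<kappa>)"
    using assms finite_imageD by blast
  moreover have "range \<kappa> \<subseteq> local_at_0 // r"
    unfolding \<kappa>_def using const by (auto intro: quotientI)
  ultimately show ?thesis
    unfolding residue_ring_def r_def t_def using finite_subset by blast
qed

lemma V_st_eq: "V_st = local_at_0"
  unfolding V_st_def local_at_0_def by (simp add: poly_eq_0_iff_dvd)

lemma CHAR_fract: "CHAR('a::idom fract) = CHAR('a)"
proof -
  have "to_fract (of_nat n) = (of_nat n :: 'a fract)" for n
    by (induction n) simp_all
  then have "(of_nat n :: 'a fract) = 0 \<longleftrightarrow> CHAR('a) dvd n" for n :: nat
    using of_nat_eq_0_iff_char_dvd[where 'a = 'a] to_fract_eq_0_iff[of "of_nat n :: 'a"] by simp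
  then show ?thesis by (intro CHAR_eqI) auto
qed

lemma CHAR_bit: "CHAR(bit) = 2"
proof -
  have "(of_nat n :: bit) = (if even n then 0 else 1)" for n
    by (induction n) auto
  then show ?thesis by (intro CHAR_eqI) (auto split: if_splits)
qed

lemma infinite_fract_poly: "infinite (UNIV :: 'a::idom poly fract set)"
proof -
  have "inj (\<lambda>n. to_fract (monom (1::'a) n))"
    by (rule injI) (simp add: monom_eq_iff')
  then have "infinite (range (\<lambda>n. to_fract (monom (1::'a) n)))"
    using finite_imageD infinite_UNIV_nat by blast
  then show ?thesis using finite_subset[OF subset_UNIV] by blast
qed

theorem theorem1p1:
  shows "(\<forall>(V :: 'k::field set) p.
            CHAR('k) = 2 \<and> discrete_valuation_domain V \<and> uniformizer V p \<and>
            infinite (residue_ring V p) \<longrightarrow>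
            (\<exists>A :: 'k poly poly fract set.
               subring_of_field A \<and> ratfun_const ` F2_plus V p \<subseteq> A \<and>
               mpoly_const ` int_valued (F2_plus V p) 1 \<subseteq> int_valued A 1 \<and>
               (\<forall>n\<ge>2. \<not> mpoly_const ` int_valued (F2_plus V p) n \<subseteq> int_valued A n)))
       \<and> (CHAR(bit poly fract poly fract) = 2 \<and> discrete_valuation_domain V_st \<and>
          uniformizer V_st t_elem \<and> infinite (residue_ring V_st t_elem) \<and>
          (\<exists>A :: bit poly fract poly fract poly poly fract set.
             subring_of_field A \<and> ratfun_const ` F2_plus V_st t_elem \<subseteq> A \<and>
             mpoly_const ` int_valued (F2_plus V_st t_elem) 1 \<subseteq> int_valued A 1 \<and>
             (\<forall>n\<ge>2. \<not> mpoly_const ` int_valued (F2_plus V_st t_elem) n \<subseteq> int_valued A n)))"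
proof -
  have char: "CHAR(bit poly fract poly fract) = 2"
    by (simp add: CHAR_fract CHAR_bit)
  have dvd: "discrete_valuation_domain V_st"
    unfolding V_st_eq by (rule discrete_valuation_domain_local_at_0)
  have unif: "uniformizer V_st t_elem"
    unfolding V_st_eq t_elem_def by (rule uniformizer_local_at_0)
  have res: "infinite (residue_ring V_st t_elem)"
    unfolding V_st_eq t_elem_def
    by (rule infinite_residue_ring_local_at_0) (rule infinite_fract_poly)
  show ?thesis
    using overring_separating_int_valued
    by (intro conjI allI impI char dvd unif res overring_separating_int_valued[OF char dvd unif res])
       blast
qed

end
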